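(* Let $n\ge 2$ and let $$B_n=\forall X\,\forall Y_1\dots\forall Y_n\,\Big\{(Y_1\to X),\dots,(Y_n\to X)\to \Big([Y_1,\dots,Y_n\to (X\wedge Y_1\wedge\dots\wedge Y_n)]\wedge (Y_1\to X)\wedge\dots\wedge (Y_n\to X)\Big)\Big\}.$$ For $1\le i\le n$ let $$T_i=\lambda x_1\dots\lambda x_n\,\big\langle \lambda y_1\dots\lambda y_n\langle (x_i)y_i,y_1,\dots,y_n\rangle,\;x_1,\dots,x_n\big\rangle .$$ Then $B_n$ is an $I$-type of order $n$, and $\Lambda(B_n)=\{T_1,\dots,T_n\}$.
   Context: $\lambda$-terms are untyped; $(t)u$ denotes application and $(t)u_1\dots u_n$ denotes $(\dots((t)u_1)\dots)u_n$. The set of $\lambda I$-terms is defined inductively: variables are $\lambda I$-terms; if $u,v$ are $\lambda I$-terms so is $(u)v$; if $u$ is a $\lambda I$-term and $x$ is free in $u$ then $\lambda x\,u$ is a $\lambda I$-term. System $\mathcal{F}$ (Curry style). Types are built from type variables $X,Y,\dots$ by $E\to F$ and $\forall X\,E$, and are identified up to renaming of bound variables. Typing rules: (ax) $x_1:A_1,\dots,x_n:A_n\vdash x_i:A_i$; ($\to_i$) from $\Gamma,x:A\vdash t:B$ infer $\Gamma\vdash\lambda x\,t:A\to B$; ($\to_e$) from $\Gamma\vdash u:A\to B$ and $\Gamma\vdash v:A$ infer $\Gamma\vdash (u)v:B$; ($\forall_i$) from $\Gamma\vdash t:A$ with $X$ not free in $\Gamma$ infer $\Gamma\vdash t:\forall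 X A$; ($\forall_e$) from $\Gamma\vdash t:\forall XA$ infer $\Gamma\vdash t:A[G/X]$ for any type $G$. Derivability is written $\Gamma\vdash_{\mathcal F}t:A$. Standing convention: only proper types are used, also inside derivations; a type is proper if for each of its subtypes $\forall X E$ the variable $X$ is free in $E$. Notation: $A_1,\dots,A_k\to A$ means $A_1\to(A_2\to\dots(A_k\to A)\dots)$. For types $A_1,\dots,A_k$, $A_1\wedge\dots\wedge A_k$ is the type $\forall Z\{(A_1,\dots,A_k\to Z)\to Z\}$ with $Z$ not occurring in $A_1,\dots,A_k$ (a $k$-ary operation, not iterated binary conjunction; in $B_n$ both conjunctions are $(n+1)$-ary). For $\lambda$-terms $t_1,\dots,t_k$, $\langle t_1,\dots,t_k\rangle=\lambda x\,(x)t_1\dots t_k$ with $x$ not free in the $t_j$. A closed type $D$ is an $I$-type if every closed $\beta$-normal $\lambda$-term $t$ with $\vdash_{\mathcal F}t:D$ is a $\lambda I$-term. $\Lambda(D)$ is the set of closed $\beta\eta$-normal $\lambda$-terms $t$ (up to $\alpha$-equivalence) with $\vdash_{\mathcal F}t:D$. An $I$-type $D$ is of order $n$ if $\mathrm{Card}(\Lambda(D))=n$. *)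

theory Defs
  imports Main
begin

text \<open>
  Terms and types are represented with de Bruijn indices, so that equality of the
  datatypes is equality up to renaming of bound variables.
\<close>

section \<open>Untyped terms\<close>

datatype tm = Var nat | App tm tm | Lam tm

primrec fv :: "tm \<Rightarrow> nat set" where
  "fv (Var i) = {i}"
| "fv (App u v) = fv u \<union> fv v"
| "fv (Lam u) = {i. Suc i \<in> fv u}"

definition closed_tm :: "tm \<Rightarrow> bool" where
  "closed_tm t \<longleftrightarrow> fv t = {}"

text \<open>\<open>lift k t\<close> makes room for a new variable with index \<open>k\<close>.\<close>

primrec lift :: "nat \<Rightarrow> tm \<Rightarrow> tm" where
  "lift k (Var i) = Var (if i < k then i else Suc i)"
| "lift k (App u v) = App (lift k u) (lift k v)"
| "lift k (Lam u) = Lam (lift (Suc k) u)"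

text \<open>
  \<open>subst k s t\<close> replaces the variable \<open>k\<close> of \<open>t\<close> by \<open>s\<close> and removes the index \<open>k\<close>
  (larger indices are decremented).
\<close>

primrec subst :: "nat \<Rightarrow> tm \<Rightarrow> tm \<Rightarrow> tm" where
  "subst k s (Var i) = (if i < k then Var i else if i = k then s else Var (i - 1))"
| "subst k s (App u v) = App (subst k s u) (subst k s v)"
| "subst k s (Lam u) = Lam (subst (Suc k) (lift 0 s) u)"

inductive beta :: "tm \<Rightarrow> tm \<Rightarrow> bool" where
  beta_redex: "beta (App (Lam u) v) (subst 0 v u)"
| beta_appL: "beta u u' \<Longrightarrow> beta (App u v) (App u' v)"
| beta_appR: "beta v v' \<Longrightarrow> beta (App u v) (App u v')"
| beta_lam: "beta u u' \<Longrightarrow> beta (Lam u) (Lam u')"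

text \<open>In \<open>eta_redex\<close>, the term \<open>lift 0 u\<close> is \<open>u\<close> seen under a binder whose variable
  does not occur in it.\<close>

inductive eta :: "tm \<Rightarrow> tm \<Rightarrow> bool" where
  eta_redex: "eta (Lam (App (lift 0 u) (Var 0))) u"
| eta_appL: "eta u u' \<Longrightarrow> eta (App u v) (App u' v)"
| eta_appR: "eta v v' \<Longrightarrow> eta (App u v) (App u v')"
| eta_lam: "eta u u' \<Longrightarrow> eta (Lam u) (Lam u')"

definition beta_normal :: "tm \<Rightarrow> bool" where
  "beta_normal t \<longleftrightarrow> (\<nexists>t'. beta t t')"

definition beta_eta_normal :: "tm \<Rightarrow> bool" where
  "beta_eta_normal t \<longleftrightarrow> (\<nexists>t'. beta t t' \<or> eta t t')"

inductive lambda_I :: "tm \<Rightarrow> bool" where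
  lambda_I_var: "lambda_I (Var i)"
| lambda_I_app: "lambda_I u \<Longrightarrow> lambda_I v \<Longrightarrow> lambda_I (App u v)"
| lambda_I_lam: "lambda_I u \<Longrightarrow> 0 \<in> fv u \<Longrightarrow> lambda_I (Lam u)"

definition lams :: "nat \<Rightarrow> tm \<Rightarrow> tm" where
  "lams n t = (Lam ^^ n) t"

definition apps :: "tm \<Rightarrow> tm list \<Rightarrow> tm" where
  "apps u vs = foldl App u vs"

text \<open>The components of a tuple are lifted because its binder must not capture
  their free variables.\<close>

definition tuple :: "tm list \<Rightarrow> tm" where
  "tuple ts = Lam (apps (Var 0) (map (lift 0) ts))"

section \<open>Types of system F\<close>

datatype ty = TVar nat | Arr ty ty (infixr \<open>\<rightarrow>\<^sub>F\<close> 65) | Forall ty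

primrec ftv :: "ty \<Rightarrow> nat set" where
  "ftv (TVar i) = {i}"
| "ftv (A \<rightarrow>\<^sub>F B) = ftv A \<union> ftv B"
| "ftv (Forall A) = {i. Suc i \<in> ftv A}"

definition closed_ty :: "ty \<Rightarrow> bool" where
  "closed_ty A \<longleftrightarrow> ftv A = {}"

primrec subtypes :: "ty \<Rightarrow> ty set" where
  "subtypes (TVar i) = {TVar i}"
| "subtypes (A \<rightarrow>\<^sub>F B) = insert (A \<rightarrow>\<^sub>F B) (subtypes A \<union> subtypes B)"
| "subtypes (Forall A) = insert (Forall A) (subtypes A)"

definition proper :: "ty \<Rightarrow> bool" where
  "proper A \<longleftrightarrow> (\<forall>E. Forall E \<in> subtypes A \<longrightarrow> 0 \<in> ftv E)"

primrec tlift :: "nat \<Rightarrow> ty \<Rightarrow> ty" where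
  "tlift k (TVar i) = TVar (if i < k then i else Suc i)"
| "tlift k (A \<rightarrow>\<^sub>F B) = tlift k A \<rightarrow>\<^sub>F tlift k B"
| "tlift k (Forall A) = Forall (tlift (Suc k) A)"

primrec tsubst :: "nat \<Rightarrow> ty \<Rightarrow> ty \<Rightarrow> ty" where
  "tsubst k G (TVar i) = (if i < k then TVar i else if i = k then G else TVar (i - 1))"
| "tsubst k G (A \<rightarrow>\<^sub>F B) = tsubst k G A \<rightarrow>\<^sub>F tsubst k G B"
| "tsubst k G (Forall A) = Forall (tsubst (Suc k) (tlift 0 G) A)"

definition foralls :: "nat \<Rightarrow> ty \<Rightarrow> ty" where
  "foralls n A = (Forall ^^ n) A"

definition arrs :: "ty list \<Rightarrow> ty \<Rightarrow> ty" where
  "arrs As A = foldr Arr As A"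

text \<open>Lifting the conjuncts expresses that \<open>Z\<close>, which is \<open>TVar 0\<close> here, does not
  occur in them.\<close>

definition conj_ty :: "ty list \<Rightarrow> ty" where
  "conj_ty As = Forall (arrs (map (tlift 0) As) (TVar 0) \<rightarrow>\<^sub>F TVar 0)"

section \<open>Typing\<close>

text \<open>
  The term variable \<open>i\<close> has type \<open>\<Gamma> ! i\<close>. In \<open>forall_I\<close>, lifting the context expresses
  that the generalised variable is not free in it. All types of a derivation are proper;
  it is enough to require this in the three rules below that mention \<open>proper\<close>.
\<close>

inductive typing :: "ty list \<Rightarrow> tm \<Rightarrow> ty \<Rightarrow> bool" (\<open>_ \<turnstile>\<^sub>F _ : _\<close> [50, 50, 50] 50) where
  ax: "\<forall>A \<in> set \<Gamma>. proper A \<Longrightarrow> i < length \<Gamma> \<Longrightarrow> \<Gamma> \<turnstile>\<^sub>F Var i : \<Gamma> ! i"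
| arr_I: "A # \<Gamma> \<turnstile>\<^sub>F t : B \<Longrightarrow> \<Gamma> \<turnstile>\<^sub>F Lam t : A \<rightarrow>\<^sub>F B"
| arr_E: "\<Gamma> \<turnstile>\<^sub>F u : A \<rightarrow>\<^sub>F B \<Longrightarrow> \<Gamma> \<turnstile>\<^sub>F v : A \<Longrightarrow> \<Gamma> \<turnstile>\<^sub>F App u v : B"
| forall_I: "map (tlift 0) \<Gamma> \<turnstile>\<^sub>F t : A \<Longrightarrow> proper (Forall A) \<Longrightarrow> \<Gamma> \<turnstile>\<^sub>F t : Forall A"
| forall_E: "\<Gamma> \<turnstile>\<^sub>F t : Forall A \<Longrightarrow> proper G \<Longrightarrow> \<Gamma> \<turnstile>\<^sub>F t : tsubst 0 G A"

section \<open>\<open>I\<close>-types and their order\<close>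

definition I_type :: "ty \<Rightarrow> bool" where
  "I_type D \<longleftrightarrow> proper D \<and> closed_ty D \<and>
     (\<forall>t. closed_tm t \<and> beta_normal t \<and> [] \<turnstile>\<^sub>F t : D \<longrightarrow> lambda_I t)"

definition Lambda :: "ty \<Rightarrow> tm set" where
  "Lambda D = {t. closed_tm t \<and> beta_eta_normal t \<and> [] \<turnstile>\<^sub>F t : D}"

definition I_type_of_order :: "ty \<Rightarrow> nat \<Rightarrow> bool" where
  "I_type_of_order D n \<longleftrightarrow> I_type D \<and> finite (Lambda D) \<and> card (Lambda D) = n"

section \<open>The types \<open>B\<^sub>n\<close> and the terms \<open>T\<^sub>i\<close>\<close>

text \<open>
  Under the prefix \<open>\<forall>X \<forall>Y\<^sub>1 \<dots> \<forall>Y\<^sub>n\<close> the variable \<open>Y\<^sub>i\<close> has index \<open>n - i\<close> and \<open>X\<close> has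
  index \<open>n\<close>.
\<close>

definition B :: "nat \<Rightarrow> ty" where
  "B n =
    (let X = TVar n;
         Y = (\<lambda>i. TVar (n - i));
         Ys = map Y [1..<Suc n];
         YXs = map (\<lambda>i. Y i \<rightarrow>\<^sub>F X) [1..<Suc n]
     in foralls (Suc n) (arrs YXs (conj_ty (arrs Ys (conj_ty (X # Ys)) # YXs))))"

text \<open>
  Under \<open>\<lambda>x\<^sub>1 \<dots> \<lambda>x\<^sub>n\<close> the variable \<open>x\<^sub>j\<close> has index \<open>n - j\<close>; under the further binders
  \<open>\<lambda>y\<^sub>1 \<dots> \<lambda>y\<^sub>n\<close> the variable \<open>y\<^sub>j\<close> has index \<open>n - j\<close> and \<open>x\<^sub>j\<close> has index \<open>n + (n - j)\<close>.
  The binders of the tuples are accounted for by \<^const>\<open>tuple\<close> itself.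
\<close>

definition T :: "nat \<Rightarrow> nat \<Rightarrow> tm" where
  "T n i =
    (let xs = map (\<lambda>j. Var (n - j)) [1..<Suc n];
         ys = map (\<lambda>j. Var (n - j)) [1..<Suc n];
         xi_yi = App (Var (n + (n - i))) (Var (n - i))
     in lams n (tuple (lams n (tuple (xi_yi # ys)) # xs)))"

end

(* Every type in a context that arises when an inhabitant of B_n is analysed ends, after its
   arrows, in a type variable. In such a context the type of a normal term x t_1 ... t_k is
   read off the type of x: forall-elimination does not apply to it, and forall-introduction
   would produce an improper type. A typed abstraction, in turn, can be typed without
   quantifier detours because typing is stable under substitution of types. So a normal
   inhabitant is determined step by step from its type: the only choices are the x_i used to
   produce X from the y_j, and whether each component x_j is eta-expanded. *)

theory Submission
  imports Defs
begin

section \<open>Substitution in types\<close>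

lemma tlift_tlift: "k \<le> l \<Longrightarrow> tlift (Suc l) (tlift k A) = tlift k (tlift l A)"
  by (induction A arbitrary: k l) auto

lemma tsubst_tlift [simp]: "tsubst k G (tlift k A) = A"
  by (induction A arbitrary: k G) auto

lemma tlift_tsubst:
  "k \<le> l \<Longrightarrow> tlift k (tsubst l G A) = tsubst (Suc l) (tlift k G) (tlift k A)"
  by (induction A arbitrary: k l G) (auto simp: tlift_tlift)

text \<open>Used with \<open>k = 0\<close> to carry an instance of \<open>forall_E\<close> through a
  substitution performed on the whole derivation.\<close>

lemma tsubst_tsubst:
  "k \<le> l \<Longrightarrow>
   tsubst l G (tsubst k H A) = tsubst k (tsubst l G H) (tsubst (Suc l) (tlift k G) A)"
proof (induction A arbitrary: k l G H)
  case (Forall A)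
  then show ?case
    using tlift_tlift[of 0 k G] tlift_tsubst[of 0 l G H] by simp
qed auto

lemma ftv_tlift: "ftv (tlift k A) = (\<lambda>i. if i < k then i else Suc i) ` ftv A"
proof (induction A arbitrary: k)
  case (Forall A)
  show ?case
  proof (intro set_eqI)
    fix i
    show "i \<in> ftv (tlift k (Forall A)) \<longleftrightarrow>
          i \<in> (\<lambda>i. if i < k then i else Suc i) ` ftv (Forall A)"
    proof
      assume "i \<in> ftv (tlift k (Forall A))"
      then obtain j where j: "j \<in> ftv A" "Suc i = (if j < Suc k then j else Suc j)"
        using Forall[of "Suc k"] by auto
      show "i \<in> (\<lambda>i. if i < k then i else Suc i) ` ftv (Forall A)"
        using j by (intro image_eqI[of _ _ "j - 1"]) (auto split: if_splits)
    next
      assume "i \<in> (\<lambda>i. if i < k then i else Suc i) ` ftv (Forall A)"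
      then show "i \<in> ftv (tlift k (Forall A))"
        using Forall[of "Suc k"] by (auto simp: image_iff split: if_splits)
    qed
  qed
qed auto

text \<open>Under a quantifier the substitution acts at a positive index, so the bound variable 0
  survives in the body. This is why substituting a proper type keeps a type proper.\<close>

lemma ftv_tsubst_below: "j < k \<Longrightarrow> j \<in> ftv A \<Longrightarrow> j \<in> ftv (tsubst k G A)"
  by (induction A arbitrary: j k G) auto

lemma zero_not_in_ftv_tlift [simp]: "0 \<notin> ftv (tlift 0 A)"
  by (auto simp: ftv_tlift)

section \<open>Proper types\<close>

lemma proper_simps [simp]:
  "proper (TVar i)"
  "proper (A \<rightarrow>\<^sub>F C) \<longleftrightarrow> proper A \<and> proper C"
  "proper (Forall A) \<longleftrightarrow> 0 \<in> ftv A \<and> proper A"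
  by (auto simp: proper_def)

lemma proper_tlift [simp]: "proper (tlift k A) \<longleftrightarrow> proper A"
proof (induction A arbitrary: k)
  case (Forall A)
  then show ?case
    by (auto simp: ftv_tlift image_iff split: if_splits)
qed auto

lemma proper_tsubst: "proper A \<Longrightarrow> proper G \<Longrightarrow> proper (tsubst k G A)"
  by (induction A arbitrary: k G) (auto intro: ftv_tsubst_below)

lemma arrs_simps [simp]:
  "arrs [] A = A"
  "arrs (C # As) A = (C \<rightarrow>\<^sub>F arrs As A)"
  by (simp_all add: arrs_def)

lemma arrs_append: "arrs (As @ Bs) A = arrs As (arrs Bs A)"
  by (simp add: arrs_def)

lemma ftv_arrs [simp]: "ftv (arrs As A) = \<Union> (ftv ` set As) \<union> ftv A"
  by (induction As) auto

lemma proper_arrs [simp]: "proper (arrs As A) \<longleftrightarrow> (\<forall>C \<in> set As. proper C) \<and> proper A"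
  by (induction As) auto

lemma tlift_arrs [simp]: "tlift k (arrs As A) = arrs (map (tlift k) As) (tlift k A)"
  by (induction As) auto

lemma arrs_eq_TVar [simp]:
  "TVar p = arrs As (TVar j) \<longleftrightarrow> As = [] \<and> p = j"
  by (cases As) auto

lemma arrs_TVar_eq_arr [simp]:
  "C \<rightarrow>\<^sub>F TVar q = arrs As (TVar j) \<longleftrightarrow> As = [C] \<and> q = j"
  by (cases As) auto

lemma arrs_eq_arr_TVar [simp]:
  "C \<rightarrow>\<^sub>F TVar q = arrs As (D \<rightarrow>\<^sub>F E) \<longleftrightarrow> As = [] \<and> C = D \<and> TVar q = E"
proof (cases As)
  case (Cons A' As')
  then show ?thesis by (cases As') auto
qed auto

lemma arrs_TVar_inject [simp]:
  "arrs As (TVar i) = arrs Cs (TVar j) \<longleftrightarrow> As = Cs \<and> i = j"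
proof (induction As arbitrary: Cs)
  case (Cons A As)
  then show ?case by (cases Cs) auto
qed auto

lemma proper_conj_ty [simp]: "proper (conj_ty As) \<longleftrightarrow> (\<forall>A \<in> set As. proper A)"
  by (auto simp: conj_ty_def)

lemma ftv_conj_ty [simp]: "ftv (conj_ty As) = \<Union> (ftv ` set As)"
  by (auto simp: conj_ty_def ftv_tlift)

lemma tlift_conj_ty [simp]: "tlift k (conj_ty As) = conj_ty (map (tlift k) As)"
  by (simp add: conj_ty_def tlift_tlift[of 0, symmetric])

lemma foralls_simps [simp]:
  "foralls 0 A = A"
  "foralls (Suc k) A = Forall (foralls k A)"
  by (simp_all add: foralls_def)

lemma ftv_foralls: "ftv (foralls k A) = {i. i + k \<in> ftv A}"
  by (induction k) auto

lemma proper_foralls: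
  "proper A \<Longrightarrow> {..<k} \<subseteq> ftv A \<Longrightarrow> proper (foralls k A)"
  by (induction k) (auto simp: ftv_foralls subset_iff)

section \<open>Normal terms\<close>

lemma lams_simps [simp]:
  "lams 0 t = t"
  "lams (Suc k) t = Lam (lams k t)"
  by (simp_all add: lams_def)

lemma apps_simps [simp]:
  "apps t [] = t"
  "apps t (us @ [u]) = App (apps t us) u"
  by (simp_all add: apps_def)

lemma fv_lams: "fv (lams k t) = {i. i + k \<in> fv t}"
  by (induction k) auto

lemma fv_apps [simp]: "fv (apps t us) = fv t \<union> \<Union> (fv ` set us)"
  by (induction us rule: rev_induct) auto

lemma lift_lams [simp]: "lift k (lams l t) = lams l (lift (k + l) t)"
  by (induction l arbitrary: k) auto

lemma lift_apps [simp]: "lift k (apps t us) = apps (lift k t) (map (lift k) us)"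
  by (induction us rule: rev_induct) auto

lemma apps_Var_not_Lam [simp]: "apps (Var i) us \<noteq> Lam t"
  by (cases us rule: rev_cases) auto

lemma apps_Var_eq_App:
  assumes "apps (Var i) us = App u v"
  obtains us' where "us = us' @ [v]" "u = apps (Var i) us'"
  using assms by (cases us rule: rev_cases) auto

lemma lams_inject [simp]: "lams k t = lams k u \<longleftrightarrow> t = u"
  by (induction k) auto

lemma apps_Var_inject:
  "length us = length vs \<Longrightarrow> apps (Var i) us = apps (Var i) vs \<longleftrightarrow> us = vs"
  by (induction us vs rule: rev_induct2) auto

lemma beta_normal_simps [simp]:
  "beta_normal (Var i)"
  "beta_normal (Lam u) \<longleftrightarrow> beta_normal u"
  "beta_normal (App u v) \<longleftrightarrow> beta_normal u \<and> beta_normal v \<and> (\<forall>w. u \<noteq> Lam w)"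
  unfolding beta_normal_def
  by (auto elim: beta.cases intro: beta.intros)

text \<open>Kept apart from \<open>beta_normal\<close> because \<open>I_type\<close> concerns all
  \<beta>-normal inhabitants, and only \<open>Lambda\<close> also asks for \<eta>-normality.\<close>

definition eta_normal :: "tm \<Rightarrow> bool" where
  "eta_normal t \<longleftrightarrow> (\<nexists>t'. eta t t')"

lemma beta_eta_normal_iff: "beta_eta_normal t \<longleftrightarrow> beta_normal t \<and> eta_normal t"
  by (auto simp: beta_eta_normal_def beta_normal_def eta_normal_def)

lemma eta_normal_simps [simp]:
  "eta_normal (Var i)"
  "eta_normal (Lam u) \<longleftrightarrow> eta_normal u \<and> (\<forall>w. u \<noteq> App (lift 0 w) (Var 0))"
  "eta_normal (App u v) \<longleftrightarrow> eta_normal u \<and> eta_normal v"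
  unfolding eta_normal_def
  by (auto elim: eta.cases intro: eta.intros)

lemma beta_normal_lams [simp]: "beta_normal (lams k t) \<longleftrightarrow> beta_normal t"
  by (induction k) auto

text \<open>The added binders have an abstraction as body, never an application, so none of them
  starts an \<eta>-redex.\<close>

lemma eta_normal_lams_Lam [simp]: "eta_normal (lams k (Lam t)) \<longleftrightarrow> eta_normal (Lam t)"
proof (induction k)
  case (Suc k)
  then show ?case by (cases k) auto
qed auto

lemma beta_normal_apps [simp]:
  "beta_normal (apps (Var i) us) \<longleftrightarrow> (\<forall>u \<in> set us. beta_normal u)"
  by (induction us rule: rev_induct) auto

lemma eta_normal_apps [simp]:
  "eta_normal (apps (Var i) us) \<longleftrightarrow> (\<forall>u \<in> set us. eta_normal u)"
  by (induction us rule: rev_induct) auto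

lemma beta_normal_cases:
  assumes "beta_normal t"
  obtains (Lam) u where "t = Lam u" "beta_normal u"
  | (neutral) i us where "t = apps (Var i) us" "\<forall>u \<in> set us. beta_normal u"
  using assms
proof (induction t arbitrary: thesis)
  case (Var i)
  then show ?case using apps_simps(1) by (metis empty_iff list.set(1))
next
  case (App u v)
  show ?case
  proof (rule App.IH(1))
    show "beta_normal u" using App.prems by simp
  next
    fix i us assume "u = apps (Var i) us" "\<forall>w \<in> set us. beta_normal w"
    then show ?thesis using App.prems(2)[of i "us @ [v]"] App.prems(3) by simp
  qed (use App.prems(3) in auto)
qed simp

lemma lambda_I_simps [simp]:
  "lambda_I (Var i)"
  "lambda_I (App u v) \<longleftrightarrow> lambda_I u \<and> lambda_I v"
  "lambda_I (Lam u) \<longleftrightarrow> lambda_I u \<and> 0 \<in> fv u"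
  by (auto elim: lambda_I.cases intro: lambda_I.intros)

lemma lambda_I_apps [simp]:
  "lambda_I (apps t us) \<longleftrightarrow> lambda_I t \<and> (\<forall>u \<in> set us. lambda_I u)"
  by (induction us rule: rev_induct) auto

lemma lambda_I_lams:
  "lambda_I t \<Longrightarrow> {..<k} \<subseteq> fv t \<Longrightarrow> lambda_I (lams k t)"
  by (induction k) (auto simp: fv_lams subset_iff)

section \<open>Inversion of typing\<close>

lemma typing_tsubst:
  "\<Gamma> \<turnstile>\<^sub>F t : A \<Longrightarrow> proper G \<Longrightarrow> map (tsubst k G) \<Gamma> \<turnstile>\<^sub>F t : tsubst k G A"
proof (induction arbitrary: k G rule: typing.induct)
  case (ax \<Gamma> i)
  then show ?case
    using typing.ax[of "map (tsubst k G) \<Gamma>" i] by (auto simp: proper_tsubst)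
next
  case (arr_I A \<Gamma> t C)
  then show ?case by (auto intro: typing.arr_I)
next
  case (arr_E \<Gamma> u A C v)
  then show ?case using typing.arr_E by (metis tsubst.simps(2))
next
  case (forall_I \<Gamma> t A)
  have "map (tlift 0) (map (tsubst k G) \<Gamma>)
        = map (tsubst (Suc k) (tlift 0 G)) (map (tlift 0) \<Gamma>)"
    by (simp add: tlift_tsubst)
  moreover have "proper (tsubst k G (Forall A))"
    using forall_I.hyps(2) forall_I.prems by (rule proper_tsubst)
  ultimately show ?case
    using forall_I.IH[of "tlift 0 G" "Suc k"] forall_I.prems
    by (metis proper_tlift tsubst.simps(3) typing.forall_I)
next
  case (forall_E \<Gamma> t A H)
  have "map (tsubst k G) \<Gamma> \<turnstile>\<^sub>F t : Forall (tsubst (Suc k) (tlift 0 G) A)"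
    using forall_E.IH[OF forall_E.prems] by simp
  then show ?case
    using forall_E.hyps(2) forall_E.prems
    by (auto simp: tsubst_tsubst[of 0 k] intro: typing.forall_E proper_tsubst)
qed

text \<open>What a typing of \<open>Lam t\<close> says about \<open>t\<close> once the detours through
  \<open>forall_I\<close> and \<open>forall_E\<close> are removed.\<close>

primrec lam_typing :: "ty list \<Rightarrow> tm \<Rightarrow> ty \<Rightarrow> bool" where
  "lam_typing \<Gamma> t (TVar i) \<longleftrightarrow> False"
| "lam_typing \<Gamma> t (A \<rightarrow>\<^sub>F C) \<longleftrightarrow> A # \<Gamma> \<turnstile>\<^sub>F t : C"
| "lam_typing \<Gamma> t (Forall A) \<longleftrightarrow> proper (Forall A) \<and> lam_typing (map (tlift 0) \<Gamma>) t A"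

text \<open>Absorbs a \<open>forall_E\<close> step below: at \<open>k = 0\<close> the substitution
  cancels the lifting of the context, leaving the original one.\<close>

lemma lam_typing_tsubst:
  "lam_typing \<Gamma> t A \<Longrightarrow> proper G \<Longrightarrow> lam_typing (map (tsubst k G) \<Gamma>) t (tsubst k G A)"
proof (induction A arbitrary: \<Gamma> k G)
  case (Arr A C)
  then show ?case using typing_tsubst[of "A # \<Gamma>" t C G k] by simp
next
  case (Forall A)
  have "map (tlift 0) (map (tsubst k G) \<Gamma>)
        = map (tsubst (Suc k) (tlift 0 G)) (map (tlift 0) \<Gamma>)"
    by (simp add: tlift_tsubst)
  moreover have "proper (tsubst k G (Forall A))"
    using Forall.prems by (intro proper_tsubst) simp_all
  ultimately show ?case
    using Forall.IH[of "map (tlift 0) \<Gamma>" "tlift 0 G" "Suc k"] Forall.prems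
    by (simp del: map_map)
qed simp

lemma typing_Lam_imp_lam_typing: "\<Gamma> \<turnstile>\<^sub>F Lam t : A \<Longrightarrow> lam_typing \<Gamma> t A"
proof (induction \<Gamma> "Lam t" A rule: typing.induct)
  case (forall_E \<Gamma> A G)
  then show ?case
    using lam_typing_tsubst[of "map (tlift 0) \<Gamma>" t A G 0] by (simp add: comp_def)
qed simp_all

lemma lam_typing_imp_typing_Lam: "lam_typing \<Gamma> t A \<Longrightarrow> \<Gamma> \<turnstile>\<^sub>F Lam t : A"
  by (induction A arbitrary: \<Gamma>) (auto intro: typing.intros)

lemma typing_Lam_Forall:
  "\<Gamma> \<turnstile>\<^sub>F Lam t : Forall A \<Longrightarrow> map (tlift 0) \<Gamma> \<turnstile>\<^sub>F Lam t : A"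
  using typing_Lam_imp_lam_typing lam_typing_imp_typing_Lam by fastforce

lemma typing_Lam_foralls: "[] \<turnstile>\<^sub>F Lam t : foralls k A \<Longrightarrow> [] \<turnstile>\<^sub>F Lam t : A"
  by (induction k) (auto dest: typing_Lam_Forall)

primrec target :: "ty \<Rightarrow> ty" where
  "target (TVar i) = TVar i"
| "target (A \<rightarrow>\<^sub>F C) = target C"
| "target (Forall A) = Forall A"

text \<open>A variable of rigid type exposes no quantifier, however many arguments it receives. All
  contexts met while analysing \<open>B n\<close> consist of such types.\<close>

definition rigid :: "ty \<Rightarrow> bool" where
  "rigid A \<longleftrightarrow> (\<exists>i. target A = TVar i)"

lemma rigid_simps [simp]:
  "rigid (TVar i)" "rigid (A \<rightarrow>\<^sub>F C) \<longleftrightarrow> rigid C" "\<not> rigid (Forall A)"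
  by (simp_all add: rigid_def)

lemma target_arrs [simp]: "target (arrs As A) = target A"
  by (induction As) auto

lemma rigid_arrs [simp]: "rigid (arrs As A) \<longleftrightarrow> rigid A"
  by (simp add: rigid_def)

lemma rigid_tlift [simp]: "rigid (tlift k A) \<longleftrightarrow> rigid A"
  by (induction A) auto

lemma rigid_conj_ty [simp]: "\<not> rigid (conj_ty As)"
  by (simp add: conj_ty_def)

text \<open>In a rigid context \<open>forall_E\<close> never applies to a neutral term, and \<open>forall_I\<close> never
  does because the generalised variable would not occur in the type, which would
  then be improper.\<close>

lemma typing_neutral:
  assumes "\<Gamma> \<turnstile>\<^sub>F apps (Var i) us : A" and "\<forall>C \<in> set \<Gamma>. rigid C"
  shows "i < length \<Gamma> \<and>
         (\<exists>As. \<Gamma> ! i = arrs As A \<and> list_all2 (\<lambda>u C. \<Gamma> \<turnstile>\<^sub>F u : C) us As)"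
  using assms
proof (induction \<Gamma> "apps (Var i) us" A arbitrary: us rule: typing.induct)
  case (ax \<Gamma> j)
  then have "us = [] \<and> i = j" by (cases us rule: rev_cases) auto
  then show ?case using ax by (auto intro: exI[of _ "[]"])
next
  case (arr_I A \<Gamma> t C)
  then show ?case by (metis apps_Var_not_Lam)
next
  case (arr_E \<Gamma> u A C v)
  obtain us' where us': "us = us' @ [v]" "u = apps (Var i) us'"
    using arr_E.hyps(5) by (metis apps_Var_eq_App)
  obtain As where As: "i < length \<Gamma>" "\<Gamma> ! i = arrs As (A \<rightarrow>\<^sub>F C)"
      "list_all2 (\<lambda>u C. \<Gamma> \<turnstile>\<^sub>F u : C) us' As"
    using arr_E.hyps(2)[OF us'(2) arr_E.prems] by auto
  then have "\<Gamma> ! i = arrs (As @ [A]) C"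
      "list_all2 (\<lambda>u C. \<Gamma> \<turnstile>\<^sub>F u : C) us (As @ [A])"
    using arr_E.hyps(3) us'(1) by (auto simp: arrs_append intro: list_all2_appendI)
  then show ?case using As(1) by blast
next
  case (forall_I \<Gamma> A)
  obtain As where As: "i < length \<Gamma>" "tlift 0 (\<Gamma> ! i) = arrs As A"
    using forall_I.hyps(2)[OF refl] forall_I.prems by auto
  have "0 \<in> ftv (tlift 0 (\<Gamma> ! i))"
    unfolding As(2) using forall_I.hyps(3) by simp
  then show ?case by simp
next
  case (forall_E \<Gamma> A G)
  obtain As where As: "i < length \<Gamma>" "\<Gamma> ! i = arrs As (Forall A)"
    using forall_E.hyps(2)[OF refl] forall_E.prems by auto
  then have "rigid (arrs As (Forall A))"
    using forall_E.prems by (metis nth_mem)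
  then show ?case by simp
qed

lemma typing_normal_cases:
  assumes "\<Gamma> \<turnstile>\<^sub>F t : A" "beta_normal t" "\<forall>C \<in> set \<Gamma>. rigid C"
  obtains (Lam) u where "t = Lam u" "beta_normal u" "lam_typing \<Gamma> u A"
  | (neutral) i us As where "t = apps (Var i) us" "i < length \<Gamma>" "\<Gamma> ! i = arrs As A"
      "list_all2 (\<lambda>u C. \<Gamma> \<turnstile>\<^sub>F u : C \<and> beta_normal u) us As"
  using assms(2)
proof (cases rule: beta_normal_cases)
  case (Lam u)
  then show ?thesis using that(1) assms(1) typing_Lam_imp_lam_typing by blast
next
  case (neutral i us)
  then obtain As where "i < length \<Gamma>" "\<Gamma> ! i = arrs As A"
      "list_all2 (\<lambda>u C. \<Gamma> \<turnstile>\<^sub>F u : C) us As"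
    using typing_neutral assms by blast
  moreover from this neutral(2)
  have "list_all2 (\<lambda>u C. \<Gamma> \<turnstile>\<^sub>F u : C \<and> beta_normal u) us As"
    by (auto simp: list_all2_conv_all_nth)
  ultimately show ?thesis using that(2) neutral(1) by blast
qed

text \<open>The type of a neutral term is a tail of the rigid type of its head, hence rigid itself;
  only an abstraction remains.\<close>

lemma typing_normal_not_rigid:
  assumes "\<Gamma> \<turnstile>\<^sub>F t : A" "beta_normal t" "\<forall>C \<in> set \<Gamma>. rigid C" "\<not> rigid A"
  obtains u where "t = Lam u" "beta_normal u" "lam_typing \<Gamma> u A"
  using assms(1-3)
proof (cases rule: typing_normal_cases)
  case (neutral i us As)
  then have "rigid (arrs As A)" using assms(3) by (metis nth_mem)
  then show ?thesis using assms(4) by simp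
qed (rule that)

lemma typing_normal_TVar:
  assumes "\<Gamma> \<turnstile>\<^sub>F t : TVar j" "beta_normal t" "\<forall>C \<in> set \<Gamma>. rigid C"
  obtains i us As where "t = apps (Var i) us" "i < length \<Gamma>" "\<Gamma> ! i = arrs As (TVar j)"
      "list_all2 (\<lambda>u C. \<Gamma> \<turnstile>\<^sub>F u : C \<and> beta_normal u) us As"
  using assms by (cases rule: typing_normal_cases) auto

text \<open>As the final type is not rigid, neither is any tail of the arrow type. So every argument
  must be abstracted, and no \<eta>-short form can occur.\<close>

lemma typing_normal_arrs:
  assumes "\<Gamma> \<turnstile>\<^sub>F t : arrs As A" "beta_normal t" "\<forall>C \<in> set (As @ \<Gamma>). rigid C" "\<not> rigid A"
  obtains u where "t = lams (length As) u" "beta_normal u" "rev As @ \<Gamma> \<turnstile>\<^sub>F u : A"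
  using assms(1-3)
proof (induction As arbitrary: \<Gamma> t thesis)
  case (Cons C As)
  obtain u where u: "t = Lam u" "beta_normal u" "C # \<Gamma> \<turnstile>\<^sub>F u : arrs As A"
    using Cons.prems(2-4) assms(4)
    by (elim typing_normal_not_rigid) auto
  show ?case
  proof (rule Cons.IH[OF _ u(3,2)])
    fix v assume "u = lams (length As) v" "beta_normal v" "rev As @ C # \<Gamma> \<turnstile>\<^sub>F v : A"
    then show ?thesis using Cons.prems(1) u(1) by simp
  qed (use Cons.prems(4) in auto)
qed simp

text \<open>The body has the fresh variable \<open>Z\<close> as its type. Lifted assumptions do not
  mention \<open>Z\<close>, so the head is the variable just bound, and its type demands one
  argument per conjunct. The components may still mention that variable; this is excluded later, by
  comparing targets.\<close>

lemma typing_normal_conj_ty: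
  assumes "\<Gamma> \<turnstile>\<^sub>F t : conj_ty As" "beta_normal t" "\<forall>C \<in> set \<Gamma>. rigid C"
  obtains us where "t = Lam (apps (Var 0) us)"
    "list_all2 (\<lambda>u C. arrs (map (tlift 0) As) (TVar 0) # map (tlift 0) \<Gamma> \<turnstile>\<^sub>F u : C
                      \<and> beta_normal u) us (map (tlift 0) As)"
proof -
  let ?\<Delta> = "arrs (map (tlift 0) As) (TVar 0) # map (tlift 0) \<Gamma>"
  obtain u where u: "t = Lam u" "beta_normal u" "?\<Delta> \<turnstile>\<^sub>F u : TVar 0"
    using assms(1-3) by (rule typing_normal_not_rigid) (auto simp: conj_ty_def)
  have rigid: "\<forall>C \<in> set ?\<Delta>. rigid C" using assms(3) by auto
  obtain i us As' where us: "u = apps (Var i) us" "i < length ?\<Delta>"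
      "?\<Delta> ! i = arrs As' (TVar 0)"
      "list_all2 (\<lambda>u C. ?\<Delta> \<turnstile>\<^sub>F u : C \<and> beta_normal u) us As'"
    using u(3,2) rigid by (rule typing_normal_TVar)
  have "i = 0"
  proof (rule ccontr)
    assume "i \<noteq> 0"
    then obtain k where k: "i = Suc k" "k < length \<Gamma>" using us(2) by (cases i) auto
    have "0 \<in> ftv (tlift 0 (\<Gamma> ! k))"
      using us(3) k by simp
    then show False by simp
  qed
  then show ?thesis using that us u(1) by auto
qed

section \<open>Typing of tuples\<close>

lemma typing_apps:
  assumes "\<Gamma> \<turnstile>\<^sub>F t : arrs As A" "list_all2 (\<lambda>u C. \<Gamma> \<turnstile>\<^sub>F u : C) us As"
  shows "\<Gamma> \<turnstile>\<^sub>F apps t us : A"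
  using assms(2,1)
proof (induction us As arbitrary: t rule: list_all2_induct)
  case (Cons u us C As)
  then have "\<Gamma> \<turnstile>\<^sub>F apps (App t u) us : A"
    by (intro Cons.IH) (auto intro: typing.arr_E)
  then show ?case by (simp add: apps_def)
qed simp

lemma typing_lams: "rev As @ \<Gamma> \<turnstile>\<^sub>F t : A \<Longrightarrow> \<Gamma> \<turnstile>\<^sub>F lams (length As) t : arrs As A"
  by (induction As arbitrary: \<Gamma>) (auto intro: typing.arr_I)

lemma typing_conj_ty:
  assumes "\<forall>C \<in> set (As @ \<Gamma>). proper C"
    and "list_all2 (\<lambda>u C. arrs (map (tlift 0) As) (TVar 0) # map (tlift 0) \<Gamma> \<turnstile>\<^sub>F u : C)
           us (map (tlift 0) As)"
  shows "\<Gamma> \<turnstile>\<^sub>F Lam (apps (Var 0) us) : conj_ty As"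
proof -
  let ?\<Delta> = "arrs (map (tlift 0) As) (TVar 0) # map (tlift 0) \<Gamma>"
  have "?\<Delta> \<turnstile>\<^sub>F Var 0 : arrs (map (tlift 0) As) (TVar 0)"
    using typing.ax[of ?\<Delta> 0] assms(1) by auto
  then have "?\<Delta> \<turnstile>\<^sub>F apps (Var 0) us : TVar 0"
    using assms(2) by (rule typing_apps)
  moreover have "proper (conj_ty As)" using assms(1) by simp
  ultimately show ?thesis
    unfolding conj_ty_def by (intro typing.forall_I typing.arr_I)
qed

lemma typing_foralls: "[] \<turnstile>\<^sub>F t : A \<Longrightarrow> proper (foralls k A) \<Longrightarrow> [] \<turnstile>\<^sub>F t : foralls k A"
  by (induction k) (auto intro: typing.forall_I)

section \<open>The normal inhabitants of \<open>B\<^sub>n\<close>\<close>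

text \<open>Contexts list the innermost variable first, whereas \<open>B\<close> and
  \<open>T\<close> list their variables from the outermost one via \<open>n - i\<close>. This is the
  source of every \<open>rev\<close> below.\<close>

lemma map_diff_upt: "map (\<lambda>i. f (n - i)) [1..<Suc n] = rev (map f [0..<n])"
  by (rule nth_equalityI) (auto simp: rev_nth simp del: upt_Suc)

text \<open>The contexts \<open>y\<^sub>n : Y\<^sub>n, \<dots>, y\<^sub>1 : Y\<^sub>1\<close> and \<open>x\<^sub>n : Y\<^sub>n \<rightarrow> X, \<dots>, x\<^sub>1 : Y\<^sub>1 \<rightarrow> X\<close>, under
  \<open>p\<close> type binders inside the prefix of \<open>B n\<close>.\<close>

definition ctx_y :: "nat \<Rightarrow> nat \<Rightarrow> ty list" where
  "ctx_y p n = map (\<lambda>k. TVar (p + k)) [0..<n]"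

definition ctx_x :: "nat \<Rightarrow> nat \<Rightarrow> ty list" where
  "ctx_x p n = map (\<lambda>k. TVar (p + k) \<rightarrow>\<^sub>F TVar (p + n)) [0..<n]"

lemma length_ctx [simp]: "length (ctx_y p n) = n" "length (ctx_x p n) = n"
  by (simp_all add: ctx_y_def ctx_x_def)

lemma nth_ctx [simp]:
  "k < n \<Longrightarrow> ctx_y p n ! k = TVar (p + k)"
  "k < n \<Longrightarrow> ctx_x p n ! k = TVar (p + k) \<rightarrow>\<^sub>F TVar (p + n)"
  by (simp_all add: ctx_y_def ctx_x_def)

lemma map_tlift_ctx [simp]:
  "map (tlift 0) (ctx_y p n) = ctx_y (Suc p) n"
  "map (tlift 0) (ctx_x p n) = ctx_x (Suc p) n"
  by (simp_all add: ctx_y_def ctx_x_def)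

lemma proper_ctx [simp]:
  "C \<in> set (ctx_y p n) \<Longrightarrow> proper C" "C \<in> set (ctx_x p n) \<Longrightarrow> proper C"
  by (auto simp: ctx_y_def ctx_x_def)

lemma rigid_ctx [simp]:
  "C \<in> set (ctx_y p n) \<Longrightarrow> rigid C" "C \<in> set (ctx_x p n) \<Longrightarrow> rigid C"
  by (auto simp: ctx_y_def ctx_x_def)

text \<open>The first conjunct \<open>Y_1, ..., Y_n \<rightarrow> (X \<and> Y_1 \<and> ... \<and>
  Y_n)\<close> in \<open>B n\<close>, under \<open>p\<close> further type binders;
  \<open>TVar (p + n)\<close> is \<open>X\<close>.\<close>

definition inner_ty :: "nat \<Rightarrow> nat \<Rightarrow> ty" where
  "inner_ty p n = arrs (rev (ctx_y p n)) (conj_ty (TVar (p + n) # rev (ctx_y p n)))"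

lemma tlift_inner_ty [simp]: "tlift 0 (inner_ty p n) = inner_ty (Suc p) n"
  by (simp add: inner_ty_def rev_map[symmetric])

lemma proper_inner_ty [simp]: "proper (inner_ty p n)"
  by (auto simp: inner_ty_def)

definition body_ty :: "nat \<Rightarrow> ty" where
  "body_ty n = arrs (rev (ctx_x 0 n)) (conj_ty (inner_ty 0 n # rev (ctx_x 0 n)))"

lemma B_eq: "B n = foralls (Suc n) (body_ty n)"
  using map_diff_upt[of TVar n] map_diff_upt[of "\<lambda>k. TVar k \<rightarrow>\<^sub>F TVar n" n]
  by (simp add: B_def Let_def body_ty_def inner_ty_def ctx_y_def ctx_x_def
      del: upt_Suc foralls_simps)

lemma ftv_ctx:
  "\<Union> (ftv ` set (ctx_y p n)) = {p..<p + n}"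
  "n > 0 \<Longrightarrow> \<Union> (ftv ` set (ctx_x p n)) = {p..p + n}"
proof -
  have "x \<in> (\<lambda>k. p + k) ` {..<n}" if "p \<le> x" "x < p + n" for x
    using that by (intro image_eqI[of _ _ "x - p"]) auto
  then show "\<Union> (ftv ` set (ctx_y p n)) = {p..<p + n}"
      "n > 0 \<Longrightarrow> \<Union> (ftv ` set (ctx_x p n)) = {p..p + n}"
    by (fastforce simp: ctx_y_def ctx_x_def le_eq_less_or_eq)+
qed

lemma ftv_body_ty:
  assumes "n > 0"
  shows "ftv (body_ty n) = {..n}"
proof -
  have "ftv (inner_ty 0 n) = {..n}"
    unfolding inner_ty_def by (auto simp: ftv_ctx)
  then show ?thesis
    unfolding body_ty_def using ftv_ctx(2)[OF assms, of 0] by auto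
qed

lemma proper_body_ty: "proper (body_ty n)"
  by (auto simp: body_ty_def)

lemma proper_B: "n > 0 \<Longrightarrow> proper (B n)"
  unfolding B_eq by (intro proper_foralls proper_body_ty) (auto simp: ftv_body_ty)

lemma closed_B: "n > 0 \<Longrightarrow> closed_ty (B n)"
  unfolding B_eq by (auto simp: closed_ty_def ftv_foralls ftv_body_ty simp del: foralls_simps)

section \<open>Candidate normal forms and the contexts of their components\<close>

text \<open>The first component of \<open>T n i\<close> for \<open>m = n - i\<close>, under the
  outer tuple binder. Below the inner tuple binder, y_i has index \<open>Suc m\<close>; x_i lies
  beyond both tuple binders and all the y_j.\<close>

definition inner_tm :: "nat \<Rightarrow> nat \<Rightarrow> tm" where
  "inner_tm n m = lams n (Lam (apps (Var 0)
     (App (Var (Suc (Suc (n + m)))) (Var (Suc m)) # rev (map (\<lambda>k. Var (Suc k)) [0..<n]))))"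

text \<open>The list \<open>ds\<close> is left open because a \<beta>-normal inhabitant may contain
  either x_j or its \<eta>-expansion; it is in context order, entry \<open>k\<close> belonging to
  the variable numbered \<open>n - k\<close>.\<close>

definition nf :: "nat \<Rightarrow> nat \<Rightarrow> tm list \<Rightarrow> tm" where
  "nf n m ds = lams n (Lam (apps (Var 0) (inner_tm n m # rev ds)))"

lemma T_eq_nf:
  assumes "i \<in> {1..n}"
  shows "T n i = nf n (n - i) (map (\<lambda>k. Var (Suc k)) [0..<n])"
proof -
  obtain m where m: "m < n" "i = n - m" "n - i = m"
    using assms by (metis One_nat_def atLeastAtMost_iff diff_diff_cancel diff_less less_le_trans
        zero_less_Suc le_trans)
  \<comment> \<open>The outer tuple lifts the y_j again, with a cutoff above their indices. The
    conditional left by this lifting always takes its first branch.\<close>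
  have map_eq: "map (\<lambda>k. Var (if k < n then Suc k else Suc (Suc k))) (rev [0..<n])
        = map (\<lambda>k. Var (Suc k)) (rev [0..<n])"
    by (rule map_cong) auto
  show ?thesis
    using map_diff_upt[of Var n] m
    by (simp add: T_def Let_def nf_def inner_tm_def tuple_def rev_map comp_def map_eq
        del: upt_Suc)
qed

text \<open>The contexts in which the components of the outer and of the inner tuple are typed.\<close>

definition ctx_outer :: "nat \<Rightarrow> ty list" where
  "ctx_outer n = arrs (inner_ty 1 n # rev (ctx_x 1 n)) (TVar 0) # ctx_x 1 n"

definition ctx_inner :: "nat \<Rightarrow> ty list" where
  "ctx_inner n = arrs (TVar (2 + n) # rev (ctx_y 2 n)) (TVar 0) # ctx_y 2 n
     @ arrs (inner_ty 2 n # rev (ctx_x 2 n)) (TVar 1) # ctx_x 2 n"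

lemma map_tlift_outer:
  "map (tlift 0) (inner_ty 0 n # rev (ctx_x 0 n)) = inner_ty 1 n # rev (ctx_x 1 n)"
  "map (tlift 0) (ctx_x 0 n) = ctx_x 1 n"
  by (simp_all add: rev_map[symmetric])

lemma map_tlift_inner:
  "map (tlift 0) (TVar (1 + n) # rev (ctx_y 1 n)) = TVar (2 + n) # rev (ctx_y 2 n)"
  by (simp add: rev_map[symmetric] numeral_2_eq_2)

lemma ctx_inner_eq:
  "arrs (TVar (2 + n) # rev (ctx_y 2 n)) (TVar 0) # map (tlift 0) (ctx_y 1 n @ ctx_outer n)
   = ctx_inner n"
  by (simp add: ctx_inner_def ctx_outer_def rev_map[symmetric] numeral_2_eq_2)

text \<open>In order: the inner tuple variable, the y_j, the outer tuple variable, the x_j. The type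
  variables 0 and 1 are the \<open>Z\<close> of the inner and of the outer conjunction.\<close>

lemma nth_ctx_inner:
  "ctx_inner n ! 0 = arrs (TVar (2 + n) # rev (ctx_y 2 n)) (TVar 0)"
  "k < n \<Longrightarrow> ctx_inner n ! Suc k = TVar (2 + k)"
  "ctx_inner n ! Suc n = arrs (inner_ty 2 n # rev (ctx_x 2 n)) (TVar 1)"
  "k < n \<Longrightarrow> ctx_inner n ! Suc (Suc (n + k)) = TVar (2 + k) \<rightarrow>\<^sub>F TVar (2 + n)"
  by (simp_all add: ctx_inner_def nth_append)

lemma length_ctx_inner: "length (ctx_inner n) = Suc (Suc (n + n))"
  by (simp add: ctx_inner_def)

text \<open>The two tuple variables have targets \<open>TVar 0\<close> and \<open>TVar 1\<close>, so
  neither can head a term whose type is some Y or X.\<close>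

lemma ctx_inner_cases:
  assumes "i < length (ctx_inner n)" "ctx_inner n ! i = arrs As (TVar (2 + j))"
  obtains (y) "j < n" "i = Suc j" "As = []"
  | (x) k where "k < n" "i = Suc (Suc (n + k))" "As = [TVar (2 + k)]" "j = n"
proof -
  have target: "target (ctx_inner n ! i) = TVar (2 + j)"
    using assms(2) by simp
  consider "i = 0" | k where "i = Suc k" "k < n" | "i = Suc n"
    | k where "i = Suc (Suc (n + k))" "k < n"
  proof -
    have "i = 0 \<or> i = Suc (i - 1) \<and> i - 1 < n \<or> i = Suc n
          \<or> i = Suc (Suc (n + (i - n - 2))) \<and> i - n - 2 < n"
      using assms(1) by (simp add: length_ctx_inner) linarith
    then show ?thesis using that by metis
  qed
  then show ?thesis
  proof cases
    case 1
    then show ?thesis using target by (simp add: nth_ctx_inner)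
  next
    case (2 k)
    then show ?thesis using assms(2) that(1) by (simp add: nth_ctx_inner)
  next
    case 3
    then show ?thesis using target by (simp add: nth_ctx_inner)
  next
    case (4 k)
    then have "As = [TVar (2 + k)] \<and> 2 + n = 2 + j"
      using assms(2) unfolding 4(1) nth_ctx_inner(4)[OF 4(2)] arrs_TVar_eq_arr by simp
    then show ?thesis using 4 by (intro that(2)) auto
  qed
qed

lemma rigid_ctx_inner: "\<forall>C \<in> set (ctx_inner n). rigid C"
  by (auto simp: ctx_inner_def)

lemma proper_ctx_inner: "\<forall>C \<in> set (ctx_inner n). proper C"
  by (auto simp: ctx_inner_def)

section \<open>Normal inhabitants of the component types and of \<open>B n\<close>\<close>

lemma ctx_inner_atom_y:
  assumes "ctx_inner n \<turnstile>\<^sub>F t : TVar (2 + k)" "beta_normal t" "k < n"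
  shows "t = Var (Suc k)"
proof -
  obtain i us As where *: "t = apps (Var i) us" "i < length (ctx_inner n)"
      "ctx_inner n ! i = arrs As (TVar (2 + k))"
      "list_all2 (\<lambda>u C. ctx_inner n \<turnstile>\<^sub>F u : C \<and> beta_normal u) us As"
    using assms(1,2) rigid_ctx_inner by (rule typing_normal_TVar)
  from *(2,3) show ?thesis
    by (cases rule: ctx_inner_cases) (use * assms(3) in auto)
qed

text \<open>The only choice that distinguishes the \<open>T n i\<close>: X is produced by any one of
  the x's, whose argument is then forced to be the matching y.\<close>

lemma ctx_inner_atom_x:
  assumes "ctx_inner n \<turnstile>\<^sub>F t : TVar (2 + n)" "beta_normal t"
  obtains m where "m < n" "t = App (Var (Suc (Suc (n + m)))) (Var (Suc m))"
proof -
  obtain i us As where *: "t = apps (Var i) us" "i < length (ctx_inner n)"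
      "ctx_inner n ! i = arrs As (TVar (2 + n))"
      "list_all2 (\<lambda>u C. ctx_inner n \<turnstile>\<^sub>F u : C \<and> beta_normal u) us As"
    using assms rigid_ctx_inner by (rule typing_normal_TVar)
  from *(2,3) show ?thesis
  proof (cases rule: ctx_inner_cases)
    case (x m)
    then obtain u where u: "us = [u]" "ctx_inner n \<turnstile>\<^sub>F u : TVar (2 + m)" "beta_normal u"
      using *(4) by (auto simp: list_all2_Cons2)
    then have "u = Var (Suc m)" using x(1) ctx_inner_atom_y by blast
    then show ?thesis using that[of m] x u(1) *(1) by (simp add: apps_def)
  qed simp
qed

lemma ctx_outer_cases:
  assumes "i < length (ctx_outer n)"
  obtains (z) "i = 0" | (x) k where "i = Suc k" "k < n"
  using assms by (cases i) (auto simp: ctx_outer_def)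

lemma rigid_ctx_outer: "\<forall>C \<in> set (ctx_outer n). rigid C"
  by (auto simp: ctx_outer_def)

lemma inner_ty_inhabitants:
  assumes "ctx_outer n \<turnstile>\<^sub>F t : inner_ty 1 n" "beta_normal t"
  obtains m where "m < n" "t = inner_tm n m"
proof -
  obtain u where u: "t = lams n u" "beta_normal u"
      "ctx_y 1 n @ ctx_outer n \<turnstile>\<^sub>F u : conj_ty (TVar (1 + n) # rev (ctx_y 1 n))"
    using assms unfolding inner_ty_def
    by (elim typing_normal_arrs) (auto simp: ctx_outer_def)
  have rigid: "\<forall>C \<in> set (ctx_y 1 n @ ctx_outer n). rigid C"
    using rigid_ctx_outer by auto
  obtain us where "u = Lam (apps (Var 0) us)" and
      "list_all2 (\<lambda>u C. arrs (map (tlift 0) (TVar (1 + n) # rev (ctx_y 1 n))) (TVar 0)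
           # map (tlift 0) (ctx_y 1 n @ ctx_outer n) \<turnstile>\<^sub>F u : C \<and> beta_normal u)
         us (map (tlift 0) (TVar (1 + n) # rev (ctx_y 1 n)))"
    using u(3,2) rigid by (rule typing_normal_conj_ty)
  note us = this[unfolded map_tlift_inner ctx_inner_eq]
  from us(2) obtain a bs where as: "us = a # bs" "ctx_inner n \<turnstile>\<^sub>F a : TVar (2 + n)" "beta_normal a"
      "list_all2 (\<lambda>u C. ctx_inner n \<turnstile>\<^sub>F u : C \<and> beta_normal u) bs (rev (ctx_y 2 n))"
    by (auto simp: list_all2_Cons2)
  \<comment> \<open>Reversal puts the components in context order, so that entry \<open>k\<close>
    has type \<open>TVar (2 + k)\<close>.\<close>
  then have bs: "list_all2 (\<lambda>u C. ctx_inner n \<turnstile>\<^sub>F u : C \<and> beta_normal u) (rev bs) (ctx_y 2 n)"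
    by (metis list_all2_rev rev_rev_ident)
  have "rev bs = map (\<lambda>k. Var (Suc k)) [0..<n]"
    using bs by (intro nth_equalityI)
      (auto simp: list_all2_conv_all_nth intro!: ctx_inner_atom_y)
  then have "bs = rev (map (\<lambda>k. Var (Suc k)) [0..<n])" by (simp add: rev_swap)
  moreover obtain m where "m < n" "a = App (Var (Suc (Suc (n + m)))) (Var (Suc m))"
    using as(2,3) by (rule ctx_inner_atom_x)
  ultimately show ?thesis using that u(1) us(1) as(1) by (simp add: inner_tm_def)
qed

lemma proper_ctx_outer: "\<forall>C \<in> set (ctx_outer n). proper C"
  by (auto simp: ctx_outer_def)

text \<open>Besides the variable itself only an abstraction over some y is possible. Its body has
  type X, hence is an x applied to one argument, and the only available argument is y, which fixes
  the x.\<close>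

lemma ctx_outer_arrow:
  assumes "ctx_outer n \<turnstile>\<^sub>F t : TVar (1 + k) \<rightarrow>\<^sub>F TVar (1 + n)" "beta_normal t" "k < n"
  shows "t = Var (Suc k) \<or> t = Lam (App (Var (Suc (Suc k))) (Var 0))"
  using assms(1,2) rigid_ctx_outer
proof (cases rule: typing_normal_cases)
  case (Lam u)
  let ?\<Delta> = "TVar (1 + k) # ctx_outer n"
  have rigid: "\<forall>C \<in> set ?\<Delta>. rigid C" using rigid_ctx_outer by auto
  \<comment> \<open>No assumption in \<open>ctx_outer n\<close> has a Y as target, so the newly
    bound variable is the only source of one.\<close>
  have y: "v = Var 0 \<and> l = k" if v: "?\<Delta> \<turnstile>\<^sub>F v : TVar (1 + l)" "beta_normal v" "l < n" for v l
  proof -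
    obtain i us As where *: "v = apps (Var i) us" "i < length ?\<Delta>"
        "?\<Delta> ! i = arrs As (TVar (1 + l))"
        "list_all2 (\<lambda>u C. ?\<Delta> \<turnstile>\<^sub>F u : C \<and> beta_normal u) us As"
      using v(1,2) rigid by (rule typing_normal_TVar)
    show ?thesis
    proof (cases i)
      case 0
      then show ?thesis using * by auto
    next
      case (Suc i')
      then have "i' < length (ctx_outer n)" using * by simp
      then show ?thesis
        by (cases rule: ctx_outer_cases)
          (use * Suc v(3) in \<open>auto simp: ctx_outer_def simp del: arrs_simps\<close>)
    qed
  qed
  obtain i us As where *: "u = apps (Var i) us" "i < length ?\<Delta>"
      "?\<Delta> ! i = arrs As (TVar (1 + n))"
      "list_all2 (\<lambda>u C. ?\<Delta> \<turnstile>\<^sub>F u : C \<and> beta_normal u) us As"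
    using Lam(3)[simplified lam_typing.simps] Lam(2) rigid by (rule typing_normal_TVar)
  show ?thesis
  proof (cases i)
    case 0
    then show ?thesis using * assms(3) by auto
  next
    case (Suc i')
    then have "i' < length (ctx_outer n)" using * by simp
    then show ?thesis
    proof (cases rule: ctx_outer_cases)
      case z
      then show ?thesis using * Suc by (auto simp: ctx_outer_def simp del: arrs_simps)
    next
      case (x l)
      then have "As = [TVar (1 + l)]" using *(3) Suc by (auto simp: ctx_outer_def)
      then obtain v where v: "us = [v]" "?\<Delta> \<turnstile>\<^sub>F v : TVar (1 + l)" "beta_normal v"
        using *(4) by (auto simp: list_all2_Cons2)
      then show ?thesis using y[OF v(2,3) x(2)] *(1) Suc x Lam(1) by (simp add: apps_def)
    qed
  qed
next
  case (neutral i us As)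
  from neutral(2) show ?thesis
  proof (cases rule: ctx_outer_cases)
    case z
    then have "target (ctx_outer n ! i) = TVar 0" by (simp add: ctx_outer_def)
    then show ?thesis using neutral(3) by simp
  next
    case (x l)
    then show ?thesis using neutral by (auto simp: ctx_outer_def)
  qed
qed

text \<open>Peels off the prefix, the n abstractions and the outer tuple, then treats each
  component. No \<eta>-normality is assumed, so that the result also serves for
  \<open>I_type\<close>.\<close>

lemma B_normal_inhabitants:
  assumes "[] \<turnstile>\<^sub>F t : B n" "beta_normal t"
  obtains m ds where "m < n" "t = nf n m ds" "length ds = n"
    "\<forall>k<n. ds ! k = Var (Suc k) \<or> ds ! k = Lam (App (Var (Suc (Suc k))) (Var 0))"
proof -
  \<comment> \<open>Quantifiers can be stripped only from the type of an abstraction;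
    \<open>t\<close> is one because a quantified type is not rigid.\<close>
  obtain t' where t': "t = Lam t'"
    using assms(1,2) unfolding B_eq by (rule typing_normal_not_rigid) auto
  have "[] \<turnstile>\<^sub>F t : body_ty n"
    using assms(1) unfolding B_eq t' by (rule typing_Lam_foralls)
  then obtain u where u: "t = lams n u" "beta_normal u"
      "ctx_x 0 n \<turnstile>\<^sub>F u : conj_ty (inner_ty 0 n # rev (ctx_x 0 n))"
    using assms(2) unfolding body_ty_def
    by (elim typing_normal_arrs) auto
  obtain us where "u = Lam (apps (Var 0) us)" and
      "list_all2 (\<lambda>u C. arrs (map (tlift 0) (inner_ty 0 n # rev (ctx_x 0 n))) (TVar 0)
           # map (tlift 0) (ctx_x 0 n) \<turnstile>\<^sub>F u : C \<and> beta_normal u)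
         us (map (tlift 0) (inner_ty 0 n # rev (ctx_x 0 n)))"
    using u(3,2) by (rule typing_normal_conj_ty) simp
  note us = this[unfolded map_tlift_outer ctx_outer_def[symmetric]]
  from us(2) obtain c ds where cds: "us = c # ds" "ctx_outer n \<turnstile>\<^sub>F c : inner_ty 1 n" "beta_normal c"
      "list_all2 (\<lambda>u C. ctx_outer n \<turnstile>\<^sub>F u : C \<and> beta_normal u) ds (rev (ctx_x 1 n))"
    by (auto simp: list_all2_Cons2)
  then have ds: "list_all2 (\<lambda>u C. ctx_outer n \<turnstile>\<^sub>F u : C \<and> beta_normal u) (rev ds) (ctx_x 1 n)"
    by (metis list_all2_rev rev_rev_ident)
  obtain m where m: "m < n" "c = inner_tm n m"
    using cds(2,3) by (rule inner_ty_inhabitants)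
  show ?thesis
  proof (rule that)
    show "m < n" by fact
    show "t = nf n m (rev ds)" using u(1) us(1) cds(1) m(2) by (simp add: nf_def)
    show "length (rev ds) = n" using ds by (simp add: list_all2_conv_all_nth)
    show "\<forall>k<n. rev ds ! k = Var (Suc k) \<or> rev ds ! k = Lam (App (Var (Suc (Suc k))) (Var 0))"
    proof (intro allI impI)
      fix k assume "k < n"
      then show "rev ds ! k = Var (Suc k) \<or> rev ds ! k = Lam (App (Var (Suc (Suc k))) (Var 0))"
        using list_all2_nthD2[OF ds, of k] by (intro ctx_outer_arrow) auto
    qed
  qed
qed

section \<open>The \<lambda>I property and the effect of \<eta>-normality\<close>

lemma lambda_I_inner_tm: "m < n \<Longrightarrow> lambda_I (inner_tm n m)"
  unfolding inner_tm_def by (intro lambda_I_lams) auto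

lemma lambda_I_nf:
  assumes "m < n" "length ds = n"
    and "\<forall>k<n. ds ! k = Var (Suc k) \<or> ds ! k = Lam (App (Var (Suc (Suc k))) (Var 0))"
  shows "lambda_I (nf n m ds)"
proof -
  have "lambda_I d" if "d \<in> set ds" for d
    using that assms(2,3) by (auto simp: in_set_conv_nth)
  \<comment> \<open>\<open>inner_tm\<close> uses just one of the x's, but each x occurs in its own
    component, expanded or not; \<open>Suc\<close> skips the tuple binder.\<close>
  moreover have "\<exists>d \<in> set ds. Suc k \<in> fv d" if "k < n" for k
    using that assms(2,3) by (intro bexI[of _ "ds ! k"]) auto
  ultimately show ?thesis
    unfolding nf_def using lambda_I_inner_tm[OF assms(1)] by (intro lambda_I_lams) auto
qed

lemma eta_normal_nf_imp_T:
  assumes "eta_normal (nf n m ds)" "m < n" "length ds = n"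
    and "\<forall>k<n. ds ! k = Var (Suc k) \<or> ds ! k = Lam (App (Var (Suc (Suc k))) (Var 0))"
  shows "nf n m ds = T n (n - m)"
proof -
  have "\<forall>d \<in> set ds. eta_normal d"
    using assms(1) by (simp add: nf_def)
  \<comment> \<open>\<open>Var (Suc (Suc k))\<close> is \<open>lift 0 (Var (Suc k))\<close>, so this
    abstraction is an \<eta>-redex.\<close>
  moreover have "\<not> eta_normal (Lam (App (Var (Suc (Suc k))) (Var 0)))" for k
    using lift.simps(1)[of 0 "Suc k"] by (metis eta_normal_simps(2) less_zeroE)
  ultimately have "ds ! k = Var (Suc k)" if "k < n" for k
    using that assms(3,4) by (metis nth_mem)
  then have "ds = map (\<lambda>k. Var (Suc k)) [0..<n]"
    using assms(3) by (intro nth_equalityI) auto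
  then show ?thesis using assms(2) by (simp add: T_eq_nf)
qed

section \<open>The terms \<open>T n i\<close>: typing, normality, closedness, distinctness\<close>

lemma typing_inner_tm:
  assumes "m < n"
  shows "ctx_outer n \<turnstile>\<^sub>F inner_tm n m : inner_ty 1 n"
proof -
  have Var: "ctx_inner n \<turnstile>\<^sub>F Var i : A" if "i < length (ctx_inner n)" "ctx_inner n ! i = A" for i A
    using typing.ax[of "ctx_inner n" i] that proper_ctx_inner by auto
  let ?a = "App (Var (Suc (Suc (n + m)))) (Var (Suc m))"
  have "ctx_inner n \<turnstile>\<^sub>F ?a : TVar (2 + n)"
    using assms by (intro typing.arr_E[of _ _ "TVar (2 + m)"] Var)
      (auto simp: ctx_inner_def nth_append)
  moreover have "ctx_inner n \<turnstile>\<^sub>F Var (Suc k) : TVar (2 + k)" if "k < n" for k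
    using that by (intro Var) (auto simp: ctx_inner_def nth_append)
  then have "list_all2 (\<lambda>u C. ctx_inner n \<turnstile>\<^sub>F u : C)
      (rev (map (\<lambda>k. Var (Suc k)) [0..<n])) (rev (ctx_y 2 n))"
    unfolding list_all2_rev by (simp add: list_all2_conv_all_nth)
  ultimately have components: "list_all2 (\<lambda>u C. ctx_inner n \<turnstile>\<^sub>F u : C)
      (?a # rev (map (\<lambda>k. Var (Suc k)) [0..<n])) (TVar (2 + n) # rev (ctx_y 2 n))"
    by (simp only: list_all2_Cons)
  have "ctx_y 1 n @ ctx_outer n \<turnstile>\<^sub>F
      Lam (apps (Var 0) (?a # rev (map (\<lambda>k. Var (Suc k)) [0..<n]))) :
      conj_ty (TVar (1 + n) # rev (ctx_y 1 n))"
  proof (rule typing_conj_ty)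
    show "\<forall>C \<in> set ((TVar (1 + n) # rev (ctx_y 1 n)) @ ctx_y 1 n @ ctx_outer n). proper C"
      using proper_ctx_outer by auto
  qed (use components in \<open>unfold map_tlift_inner ctx_inner_eq\<close>)
  then show ?thesis
    using typing_lams[of "rev (ctx_y 1 n)" "ctx_outer n"]
    by (simp add: inner_tm_def inner_ty_def)
qed

lemma typing_T:
  assumes "i \<in> {1..n}"
  shows "[] \<turnstile>\<^sub>F T n i : B n"
proof -
  have Var: "ctx_outer n \<turnstile>\<^sub>F Var i : A" if "i < length (ctx_outer n)" "ctx_outer n ! i = A" for i A
    using typing.ax[of "ctx_outer n" i] that proper_ctx_outer by auto
  let ?ds = "map (\<lambda>k. Var (Suc k)) [0..<n]"
  have "ctx_outer n \<turnstile>\<^sub>F inner_tm n (n - i) : inner_ty 1 n"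
    using assms by (intro typing_inner_tm) auto
  moreover have "ctx_outer n \<turnstile>\<^sub>F Var (Suc k) : TVar (1 + k) \<rightarrow>\<^sub>F TVar (1 + n)" if "k < n" for k
    using that by (intro Var) (auto simp: ctx_outer_def)
  then have "list_all2 (\<lambda>u C. ctx_outer n \<turnstile>\<^sub>F u : C) (rev ?ds) (rev (ctx_x 1 n))"
    unfolding list_all2_rev by (simp add: list_all2_conv_all_nth)
  ultimately have "ctx_x 0 n \<turnstile>\<^sub>F Lam (apps (Var 0) (inner_tm n (n - i) # rev ?ds)) :
      conj_ty (inner_ty 0 n # rev (ctx_x 0 n))"
    by (intro typing_conj_ty[where As = "inner_ty 0 n # rev (ctx_x 0 n)"],
        unfold map_tlift_outer ctx_outer_def[symmetric]) auto
  then have "[] \<turnstile>\<^sub>F T n i : body_ty n"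
    using typing_lams[of "rev (ctx_x 0 n)" "[]"]
    by (simp add: T_eq_nf[OF assms] nf_def body_ty_def)
  moreover have "proper (B n)" using assms by (intro proper_B) auto
  ultimately show ?thesis unfolding B_eq by (rule typing_foralls)
qed

text \<open>Shows that the tuple binders of \<open>T n i\<close> start no \<eta>-redex: the last
  component of both tuples is \<open>Var (Suc 0)\<close>.\<close>

lemma last_arg_not_zero:
  assumes "us \<noteq> []" "last us \<noteq> Var 0"
  shows "apps (Var i) us \<noteq> App u (Var 0)"
  using assms by (cases us rule: rev_cases) auto

lemma beta_eta_normal_T: "i \<in> {1..n} \<Longrightarrow> beta_eta_normal (T n i)"
  by (auto simp: beta_eta_normal_iff T_eq_nf nf_def inner_tm_def last_arg_not_zero
      last_rev hd_map)

lemma closed_T: "i \<in> {1..n} \<Longrightarrow> closed_tm (T n i)"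
  by (auto simp: T_eq_nf nf_def inner_tm_def closed_tm_def fv_lams)

text \<open>The index \<open>n - i\<close> can be read off the first component of the inner tuple,
  and it determines \<open>i\<close> within the range.\<close>

lemma inj_on_T: "inj_on (T n) {1..n}"
  by (auto simp: inj_on_def T_eq_nf nf_def inner_tm_def apps_Var_inject)

theorem mainTheorem3:
  fixes n :: nat
  assumes "n \<ge> 2"
  shows "I_type_of_order (B n) n \<and> Lambda (B n) = T n ` {1..n}"
proof -
  have n: "n > 0" using assms by simp
  have "I_type (B n)"
    unfolding I_type_def
    using proper_B[OF n] closed_B[OF n] by (auto elim!: B_normal_inhabitants intro: lambda_I_nf)
  moreover have "Lambda (B n) = T n ` {1..n}"
  proof
    show "T n ` {1..n} \<subseteq> Lambda (B n)"
      using closed_T typing_T beta_eta_normal_T by (auto simp: Lambda_def)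
    show "Lambda (B n) \<subseteq> T n ` {1..n}"
    proof
      fix t assume "t \<in> Lambda (B n)"
      then have t: "[] \<turnstile>\<^sub>F t : B n" "beta_normal t" "eta_normal t"
        by (auto simp: Lambda_def beta_eta_normal_iff)
      from t(1,2) obtain m ds where "m < n" "t = nf n m ds" "length ds = n"
        "\<forall>k<n. ds ! k = Var (Suc k) \<or> ds ! k = Lam (App (Var (Suc (Suc k))) (Var 0))"
        by (rule B_normal_inhabitants)
      \<comment> \<open>The offset \<open>m\<close> of the chosen x counts from the innermost
        binder, so its number in the statement is \<open>n - m\<close>.\<close>
      then have "t = T n (n - m)" "n - m \<in> {1..n}"
        using eta_normal_nf_imp_T t(3) by auto
      then show "t \<in> T n ` {1..n}" by blast
    qed
  qed
  ultimately show ?thesis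
    using card_image[OF inj_on_T, of n] by (simp add: I_type_of_order_def)
qed

end
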